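(* Let $\mathcal{X}\subset\mathbb{R}^D$ be any dataset of $n$ points which is to be partitioned into $k$ clusters, and let $\delta\in(0,0.5)$ and $\rho<1$. Let $C$ be the set of centers returned by the $(\rho,\delta)$-$k$-means++ algorithm described in the context. Then \[ \mathbf{E}[\operatorname{cost}(\mathcal{X},C)] = O(\rho^{-2}\ln k)\operatorname{opt}_k(\mathcal{X})+\delta\cdot O(k+\rho^{-2}\ln k)\operatorname{opt}_1(\mathcal{X}). \]
   Context: $\operatorname{cost}(\mathcal{Y},C)=\sum_{x\in\mathcal{Y}}\min_{c\in C}\|x-c\|^2$ and $\operatorname{opt}_k(\mathcal{Y})=\min_{|C|=k}\operatorname{cost}(\mathcal{Y},C)$. An approximate nearest neighbor data structure $L$ with parameter $\rho<1$ supports $\textsc{Insert}(L,p)$ and $\textsc{Query}(L,p)$; it is assumed successful, meaning: $\textsc{Query}(L,p)$ returns an inserted point $q$ with $\|p-q\|\le\frac{1}{\sqrt{\rho}}\min_{q'\in L}\|p-q'\|$, and $L$ is monotone under insertions (the distance between $p$ and $\textsc{Query}(L,p)$ is non-increasing after inserting more points). When exactly the centers $C$ have been inserted, write $\operatorname{cost}^L(x,C)=\|x-\textsc{Query}(L,x)\|^2$, $\operatorname{cost}^L(\mathcal{Y},C)=\sum_{x\in\mathcal{Y}}\operatorname{cost}^L(x,C)$, and $\pi^L(x|C)=\operatorname{cost}^L(x,C)/\operatorname{cost}^L(\mathcal{X},C)$. The $(\rho,\delta)$-$k$-means++ algorithm: choose $c_1$ uniformly at random from $\mathcal{X}$, initialize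 $L$ with parameter $\rho$, insert $c_1$, set $C=\{c_1\}$; for $i=2,\dots,k$, sample $y\in\mathcal{X}$ with probability $\pi_{(\rho,\delta)}(y|C):=(1-\delta)\pi^L(y|C)+\delta\cdot\frac1n$, set $c_i=y$, insert $c_i$ into $L$ and set $C\leftarrow C\cup\{c_i\}$; output $C$. *)

theory Defs
  imports "HOL-Probability.Probability"
begin

text \<open>
  The constants hidden in the \<open>O\<close>-notation must not depend on the dimension, so the dimension has to
  be quantified inside the statement.  The space \<open>R\<^sup>D\<close> is therefore the library's
  carrier set \<open>{x. \<forall>i\<ge>D. x i = 0}\<close> of sequences, equipped with the Euclidean norm.
\<close>

type_synonym point = "nat \<Rightarrow> real"

abbreviation R :: "nat \<Rightarrow> point set"
  where "R D \<equiv> topspace (Euclidean_space D)"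

definition edist :: "nat \<Rightarrow> point \<Rightarrow> point \<Rightarrow> real"
  where "edist D x y = L2_set (\<lambda>i. x i - y i) {..<D}"

definition cost :: "nat \<Rightarrow> point set \<Rightarrow> point set \<Rightarrow> real"
  where "cost D Y C = (\<Sum>x\<in>Y. Min ((\<lambda>c. (edist D x c)\<^sup>2) ` C))"

definition opt :: "nat \<Rightarrow> nat \<Rightarrow> point set \<Rightarrow> real"
  where "opt D k Y = (INF C\<in>{C. C \<subseteq> R D \<and> finite C \<and> card C = k}. cost D Y C)"

text \<open>
  A state of the data structure \<open>L\<close> is identified with the list of points inserted so far, in order
  of insertion: inserting \<open>p\<close> turns \<open>ps\<close> into \<open>ps @ [p]\<close>, and \<open>L ps p\<close> is the answer to the query
  \<open>p\<close> in that state.  Answers may thus depend on the whole insertion history.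
\<close>

type_synonym ann = "point list \<Rightarrow> point \<Rightarrow> point"

definition successful_ann :: "nat \<Rightarrow> real \<Rightarrow> ann \<Rightarrow> bool"
  where "successful_ann D \<rho> L \<longleftrightarrow>
    (\<forall>ps p. ps \<noteq> [] \<and> set ps \<subseteq> R D \<and> p \<in> R D \<longrightarrow>
       L ps p \<in> set ps \<and>
       edist D p (L ps p) \<le> 1 / sqrt \<rho> * Min (edist D p ` set ps)) \<and>
    (\<forall>ps q p. ps \<noteq> [] \<and> set ps \<subseteq> R D \<and> q \<in> R D \<and> p \<in> R D \<longrightarrow>
       edist D p (L (ps @ [q]) p) \<le> edist D p (L ps p))"

definition ann_cost1 :: "nat \<Rightarrow> ann \<Rightarrow> point list \<Rightarrow> point \<Rightarrow> real"
  where "ann_cost1 D L cs x = (edist D x (L cs x))\<^sup>2"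

definition ann_cost :: "nat \<Rightarrow> ann \<Rightarrow> point list \<Rightarrow> point set \<Rightarrow> real"
  where "ann_cost D L cs Y = (\<Sum>x\<in>Y. ann_cost1 D L cs x)"

text \<open>
  The quotient is \<open>0/0\<close> only when every data point is already a center, which needs at least
  \<open>card X\<close> insertions; the uniform distribution is used in that degenerate case (the cost of the
  chosen centers is then \<open>0\<close>, whatever is sampled afterwards).
\<close>

definition ann_prob :: "nat \<Rightarrow> ann \<Rightarrow> point set \<Rightarrow> point list \<Rightarrow> point \<Rightarrow> real"
  where "ann_prob D L X cs x =
    (if ann_cost D L cs X = 0 then 1 / real (card X)
     else ann_cost1 D L cs x / ann_cost D L cs X)"

definition mixed_prob :: "nat \<Rightarrow> real \<Rightarrow> ann \<Rightarrow> point set \<Rightarrow> point list \<Rightarrow> point \<Rightarrow> real"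
  where "mixed_prob D \<delta> L X cs y =
    (if y \<in> X then (1 - \<delta>) * ann_prob D L X cs y + \<delta> * (1 / real (card X)) else 0)"

definition next_center :: "nat \<Rightarrow> real \<Rightarrow> ann \<Rightarrow> point set \<Rightarrow> point list \<Rightarrow> point pmf"
  where "next_center D \<delta> L X cs = embed_pmf (mixed_prob D \<delta> L X cs)"

lemma pmf_next_center:
  assumes "finite X" "X \<noteq> {}" "0 \<le> \<delta>" "\<delta> \<le> 1"
  shows "pmf (next_center D \<delta> L X cs) y = mixed_prob D \<delta> L X cs y"
  unfolding next_center_def
proof (rule pmf_embed_pmf)
  have card: "real (card X) > 0"
    using assms by (simp add: card_gt_0_iff)
  have c1: "0 \<le> ann_cost1 D L cs x" for x
    by (simp add: ann_cost1_def)
  have c: "0 \<le> ann_cost D L cs X"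
    by (simp add: ann_cost_def c1 sum_nonneg)
  have p: "0 \<le> ann_prob D L X cs x" for x
    by (simp add: ann_prob_def c1 c)
  show nonneg: "0 \<le> mixed_prob D \<delta> L X cs x" for x
    using assms card p by (simp add: mixed_prob_def)
  have p1: "(\<Sum>x\<in>X. ann_prob D L X cs x) = 1"
  proof (cases "ann_cost D L cs X = 0")
    case True
    then show ?thesis using card by (simp add: ann_prob_def)
  next
    case False
    then have "(\<Sum>x\<in>X. ann_prob D L X cs x) = (\<Sum>x\<in>X. ann_cost1 D L cs x) / ann_cost D L cs X"
      by (simp add: ann_prob_def sum_divide_distrib)
    then show ?thesis using False by (simp add: ann_cost_def)
  qed
  have "(\<Sum>x\<in>X. mixed_prob D \<delta> L X cs x) = (1 - \<delta>) * (\<Sum>x\<in>X. ann_prob D L X cs x) + \<delta>"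
    using card by (simp add: mixed_prob_def sum.distrib sum_distrib_left)
  then have s: "(\<Sum>x\<in>X. mixed_prob D \<delta> L X cs x) = 1"
    by (simp add: p1)
  have "(\<integral>\<^sup>+ x. ennreal (mixed_prob D \<delta> L X cs x) \<partial>count_space UNIV)
      = (\<Sum>x\<in>X. ennreal (mixed_prob D \<delta> L X cs x))"
    by (rule nn_integral_count_space') (use assms in \<open>auto simp: mixed_prob_def\<close>)
  also have "\<dots> = 1"
    by (simp add: sum_ennreal nonneg s)
  finally show "(\<integral>\<^sup>+ x. ennreal (mixed_prob D \<delta> L X cs x) \<partial>count_space UNIV) = 1" .
qed

definition add_center :: "nat \<Rightarrow> real \<Rightarrow> ann \<Rightarrow> point set \<Rightarrow> point list \<Rightarrow> point list pmf"
  where "add_center D \<delta> L X cs = map_pmf (\<lambda>y. cs @ [y]) (next_center D \<delta> L X cs)"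

definition center_seq :: "nat \<Rightarrow> real \<Rightarrow> ann \<Rightarrow> point set \<Rightarrow> nat \<Rightarrow> point list pmf"
  where "center_seq D \<delta> L X k =
    ((\<lambda>p. bind_pmf p (add_center D \<delta> L X)) ^^ (k - 1)) (map_pmf (\<lambda>c. [c]) (pmf_of_set X))"

definition kmeanspp :: "nat \<Rightarrow> real \<Rightarrow> ann \<Rightarrow> point set \<Rightarrow> nat \<Rightarrow> point set pmf"
  where "kmeanspp D \<delta> L X k = map_pmf set (center_seq D \<delta> L X k)"

end

theory Submission
  imports Defs "HOL-Analysis.Harmonic_Numbers"
begin

text \<open>
  Fix reference centers \<open>Z\<close> with \<open>card Z = k\<close> and the partition of \<open>X\<close> into the clusters they
  induce. Call a cluster covered once a center has been sampled from it. After some sampling steps,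
  let \<open>V = H + U\<close> be the data-structure cost split into covered and uncovered clusters, let \<open>u\<close> be
  the number of uncovered clusters, \<open>r\<close> the number of steps that remain, and let \<open>G\<close> be \<open>8 / \<rho>\<^sup>2\<close>
  times the reference cost of the uncovered clusters. With the harmonic numbers \<open>h\<close>, the potential
  \<open>(1 + h r) (H + G) + (u - r) / u * U + \<delta> * h r * V\<close> is a supermartingale. Indeed the cost of a newly
  covered cluster is in expectation at most its share of \<open>G\<close>; a step drawn from the
  distance distribution raises the middle term in expectation by at most \<open>H / r\<close>, and a uniform step
  raises it by at most \<open>V / r\<close>. At the end the potential dominates the cost, and at the beginning
  its middle term vanishes.
\<close>

section \<open>Squared Euclidean distances\<close>

lemma edist_sq: "(edist D x y)\<^sup>2 = (\<Sum>i<D. (x i - y i)\<^sup>2)"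
  by (simp add: edist_def L2_set_def sum_nonneg)

lemma edist_nonneg: "0 \<le> edist D x y"
  by (simp add: edist_def)

lemma edist_commute: "edist D x y = edist D y x"
  by (simp add: edist_def L2_set_def power2_commute)

text \<open>Coordinatewise, twice the sum of two squares exceeds the square of the sum by the square
  of the difference.\<close>

lemma edist_sq_triangle: "(edist D x z)\<^sup>2 \<le> 2 * ((edist D x y)\<^sup>2 + (edist D y z)\<^sup>2)"
proof -
  have "(x i - z i)\<^sup>2 \<le> 2 * ((x i - y i)\<^sup>2 + (y i - z i)\<^sup>2)" for i
  proof -
    have "0 \<le> ((x i - y i) - (y i - z i))\<^sup>2" by simp
    then show ?thesis by (simp add: power2_eq_square algebra_simps)
  qed
  then show ?thesis
    unfolding edist_sq by (simp add: sum_distrib_left sum_mono flip: sum.distrib)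
qed

text \<open>After shifting by \<open>z\<close>, the double sum is the right-hand side minus twice
  the square of \<open>\<Sum>p\<in>A. g p\<close>. That square would vanish at the mean; discarding
  it allows an arbitrary \<open>z\<close>.\<close>

lemma sum_pairs_diff_sq_le:
  fixes f :: "'a \<Rightarrow> real"
  shows "(\<Sum>p\<in>A. \<Sum>q\<in>A. (f p - f q)\<^sup>2) \<le> 2 * real (card A) * (\<Sum>q\<in>A. (f q - z)\<^sup>2)"
proof -
  define g where "g p = f p - z" for p
  have "(\<Sum>p\<in>A. \<Sum>q\<in>A. (f p - f q)\<^sup>2) = (\<Sum>p\<in>A. \<Sum>q\<in>A. (g p)\<^sup>2 + (g q)\<^sup>2 - 2 * (g p * g q))"
    by (intro sum.cong) (auto simp: g_def power2_eq_square algebra_simps)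
  also have "\<dots> = 2 * real (card A) * (\<Sum>q\<in>A. (g q)\<^sup>2) - 2 * (\<Sum>p\<in>A. g p)\<^sup>2"
    by (simp add: sum.distrib sum_subtractf power2_eq_square sum_product
        flip: sum_distrib_left)
  also have "\<dots> \<le> 2 * real (card A) * (\<Sum>q\<in>A. (g q)\<^sup>2)"
    by simp
  finally show ?thesis by (simp add: g_def)
qed

text \<open>Read as an average over \<open>p\<close>: a center drawn uniformly from \<open>A\<close>
  costs in expectation at most twice as much as any reference center \<open>z\<close>. The proof
  applies the real inequality in each coordinate.\<close>

lemma sum_pairs_edist_sq_le:
  "(\<Sum>p\<in>A. \<Sum>q\<in>A. (edist D q p)\<^sup>2) \<le> 2 * real (card A) * (\<Sum>q\<in>A. (edist D q z)\<^sup>2)"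
proof -
  have "(\<Sum>p\<in>A. \<Sum>q\<in>A. (edist D q p)\<^sup>2) = (\<Sum>p\<in>A. \<Sum>i<D. \<Sum>q\<in>A. (p i - q i)\<^sup>2)"
    by (subst sum.swap[of _ A "{..<D}"]) (simp add: edist_sq power2_commute)
  also have "\<dots> = (\<Sum>i<D. \<Sum>p\<in>A. \<Sum>q\<in>A. (p i - q i)\<^sup>2)"
    by (rule sum.swap)
  also have "\<dots> \<le> (\<Sum>i<D. 2 * real (card A) * (\<Sum>q\<in>A. (q i - z i)\<^sup>2))"
    by (intro sum_mono sum_pairs_diff_sq_le)
  also have "\<dots> = 2 * real (card A) * (\<Sum>q\<in>A. (edist D q z)\<^sup>2)"
    unfolding edist_sq sum_distrib_left by (rule sum.swap)
  finally show ?thesis .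
qed

section \<open>Sampling one center\<close>

lemma ann_cost1_nonneg: "0 \<le> ann_cost1 D L cs x"
  by (simp add: ann_cost1_def)

lemma ann_cost_nonneg: "0 \<le> ann_cost D L cs A"
  by (simp add: ann_cost_def ann_cost1_nonneg sum_nonneg)

lemma ann_prob_nonneg: "0 \<le> ann_prob D L X cs x"
  by (simp add: ann_prob_def ann_cost1_nonneg ann_cost_nonneg)

lemma sum_ann_prob:
  assumes "finite X" "X \<noteq> {}"
  shows "(\<Sum>x\<in>X. ann_prob D L X cs x) = 1"
proof (cases "ann_cost D L cs X = 0")
  case True
  then show ?thesis using assms by (simp add: ann_prob_def)
next
  case False
  then have "(\<Sum>x\<in>X. ann_prob D L X cs x) = (\<Sum>x\<in>X. ann_cost1 D L cs x) / ann_cost D L cs X"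
    by (simp add: ann_prob_def sum_divide_distrib)
  then show ?thesis using False by (simp add: ann_cost_def)
qed

locale ann_seeding =
  fixes D :: nat and X :: "point set" and \<rho> :: real and L :: ann
  assumes X_sub: "X \<subseteq> R D" and finX: "finite X" and X_ne: "X \<noteq> {}"
    and rho_pos: "0 < \<rho>" and rho_less: "\<rho> < 1" and ann: "successful_ann D \<rho> L"
begin

lemma query_in:
  assumes "cs \<noteq> []" "set cs \<subseteq> X" "x \<in> X"
  shows "L cs x \<in> set cs"
  using ann assms X_sub unfolding successful_ann_def by (meson subset_iff)

lemma ann_cost1_le_center:
  assumes "cs \<noteq> []" "set cs \<subseteq> X" "x \<in> X" "c \<in> set cs"
  shows "ann_cost1 D L cs x \<le> (edist D x c)\<^sup>2 / \<rho>"
proof -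
  have "edist D x (L cs x) \<le> 1 / sqrt \<rho> * Min (edist D x ` set cs)"
    using ann assms X_sub unfolding successful_ann_def by (meson subset_iff)
  also have "\<dots> \<le> 1 / sqrt \<rho> * edist D x c"
    using assms rho_pos by (intro mult_left_mono Min_le) auto
  finally have "(edist D x (L cs x))\<^sup>2 \<le> (1 / sqrt \<rho> * edist D x c)\<^sup>2"
    by (intro power_mono edist_nonneg)
  also have "\<dots> = (edist D x c)\<^sup>2 / \<rho>"
    using rho_pos by (simp add: power_mult_distrib power_divide)
  finally show ?thesis by (simp add: ann_cost1_def)
qed

lemma ann_cost1_snoc_le:
  assumes "cs \<noteq> []" "set cs \<subseteq> X" "x \<in> X" "y \<in> X"
  shows "ann_cost1 D L (cs @ [y]) x \<le> ann_cost1 D L cs x"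
proof -
  have "edist D x (L (cs @ [y]) x) \<le> edist D x (L cs x)"
    using ann assms X_sub unfolding successful_ann_def by (meson subset_iff)
  then show ?thesis
    unfolding ann_cost1_def by (intro power_mono edist_nonneg)
qed

lemma ann_cost_snoc_le:
  assumes "cs \<noteq> []" "set cs \<subseteq> X" "A \<subseteq> X" "y \<in> X"
  shows "ann_cost D L (cs @ [y]) A \<le> ann_cost D L cs A"
  unfolding ann_cost_def using assms by (intro sum_mono ann_cost1_snoc_le) auto

lemma ann_cost_le_center:
  assumes "cs \<noteq> []" "set cs \<subseteq> X" "A \<subseteq> X" "c \<in> set cs"
  shows "ann_cost D L cs A \<le> (\<Sum>q\<in>A. (edist D q c)\<^sup>2) / \<rho>"
  unfolding ann_cost_def sum_divide_distrib
  using assms by (intro sum_mono ann_cost1_le_center) auto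

lemma cost_le_ann_cost:
  assumes "cs \<noteq> []" "set cs \<subseteq> X"
  shows "cost D X (set cs) \<le> ann_cost D L cs X"
  unfolding cost_def ann_cost_def ann_cost1_def
  using assms query_in by (intro sum_mono Min_le) auto

text \<open>The answer to the query \<open>q\<close> is a center that also competes for
  \<open>p\<close>. The approximation guarantee for \<open>p\<close> against it costs one factor
  \<open>1 / \<rho>\<close>, the triangle inequality through \<open>q\<close> a factor 2.\<close>

lemma ann_cost1_le_other:
  assumes "cs \<noteq> []" "set cs \<subseteq> X" "p \<in> X" "q \<in> X"
  shows "ann_cost1 D L cs p \<le> 2 / \<rho> * ((edist D q p)\<^sup>2 + ann_cost1 D L cs q)"
proof -
  have "ann_cost1 D L cs p \<le> (edist D p (L cs q))\<^sup>2 / \<rho>"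
    using assms by (intro ann_cost1_le_center query_in) auto
  also have "\<dots> \<le> (2 * ((edist D p q)\<^sup>2 + (edist D q (L cs q))\<^sup>2)) / \<rho>"
    using rho_pos by (intro divide_right_mono edist_sq_triangle) auto
  finally show ?thesis by (simp add: ann_cost1_def edist_commute)
qed

text \<open>Uniform sampling only needs \<open>2 / \<rho>\<close>; weakening it to the constant of
  distance sampling lets both share one reference cost.\<close>

lemma two_div_rho_le: "2 / \<rho> \<le> 8 / \<rho>\<^sup>2"
proof -
  have "2 * \<rho>\<^sup>2 \<le> 8 * \<rho>"
    using rho_pos rho_less by (simp add: power2_eq_square)
  then show ?thesis
    using rho_pos by (simp add: field_simps)
qed

text \<open>Controls a cluster when its center is drawn uniformly from it: the cost is compared with
  the distances to the new center \<open>p\<close> alone. The list \<open>cs\<close> may be empty,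
  which serves the very first center.\<close>

lemma sum_ann_cost_snoc_le:
  assumes "set cs \<subseteq> X" "A \<subseteq> X"
  shows "(\<Sum>p\<in>A. ann_cost D L (cs @ [p]) A)
    \<le> real (card A) * (8 / \<rho>\<^sup>2 * (\<Sum>q\<in>A. (edist D q z)\<^sup>2))"
proof -
  have "(\<Sum>p\<in>A. ann_cost D L (cs @ [p]) A) \<le> (\<Sum>p\<in>A. (\<Sum>q\<in>A. (edist D q p)\<^sup>2) / \<rho>)"
    using assms by (intro sum_mono ann_cost_le_center) auto
  also have "\<dots> \<le> (2 * real (card A) * (\<Sum>q\<in>A. (edist D q z)\<^sup>2)) / \<rho>"
    unfolding sum_divide_distrib[symmetric]
    using rho_pos by (intro divide_right_mono sum_pairs_edist_sq_le) auto
  also have "\<dots> = 2 / \<rho> * (real (card A) * (\<Sum>q\<in>A. (edist D q z)\<^sup>2))"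
    by simp
  also have "\<dots> \<le> 8 / \<rho>\<^sup>2 * (real (card A) * (\<Sum>q\<in>A. (edist D q z)\<^sup>2))"
    by (intro mult_right_mono two_div_rho_le) (auto intro!: mult_nonneg_nonneg sum_nonneg)
  finally show ?thesis by (simp add: mult_ac)
qed

text \<open>The counterpart for a center drawn from \<open>A\<close> proportionally to its current
  cost. The weight \<open>d p\<close> is bounded by averaging over all \<open>q\<close> in
  \<open>A\<close>; the factor 8 is 4 from the pointwise bound times 2 from the sum over
  pairs.\<close>

lemma sum_weighted_ann_cost_snoc_le:
  assumes "cs \<noteq> []" "set cs \<subseteq> X" "A \<subseteq> X"
  shows "(\<Sum>p\<in>A. ann_cost1 D L cs p * ann_cost D L (cs @ [p]) A)
    \<le> ann_cost D L cs A * (8 / \<rho>\<^sup>2 * (\<Sum>q\<in>A. (edist D q z)\<^sup>2))"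
proof (cases "A = {}")
  case False
  define d where "d = ann_cost1 D L cs"
  define W where "W p = ann_cost D L (cs @ [p]) A" for p
  define V where "V = ann_cost D L cs A"
  define s where "s p = (\<Sum>q\<in>A. (edist D q p)\<^sup>2)" for p
  define m where "m = real (card A)"
  have "finite A" using assms finX finite_subset by blast
  then have m: "m > 0" using False by (simp add: m_def card_gt_0_iff)
  have V: "V \<ge> 0" by (simp add: V_def ann_cost_nonneg)
  have s: "s p \<ge> 0" for p by (simp add: s_def sum_nonneg)
  have avg: "m * d p \<le> 2 / \<rho> * (s p + V)" if "p \<in> A" for p
  proof -
    have "m * d p = (\<Sum>q\<in>A. d p)" by (simp add: m_def)
    also have "\<dots> \<le> (\<Sum>q\<in>A. 2 / \<rho> * ((edist D q p)\<^sup>2 + d q))"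
      unfolding d_def using assms that by (intro sum_mono ann_cost1_le_other) auto
    also have "\<dots> = 2 / \<rho> * (s p + V)"
      unfolding s_def V_def d_def ann_cost_def sum_distrib_left[symmetric] sum.distrib ..
    finally show ?thesis .
  qed
  have point: "m * (d p * W p) \<le> 4 / \<rho>\<^sup>2 * V * s p" if "p \<in> A" for p
  proof -
    have W0: "W p \<ge> 0" by (simp add: W_def ann_cost_nonneg)
    have W1: "W p \<le> V"
      unfolding W_def V_def using assms that by (intro ann_cost_snoc_le) auto
    have W2: "W p \<le> s p / \<rho>"
      unfolding W_def s_def using assms that by (intro ann_cost_le_center) auto
    have "m * (d p * W p) \<le> 2 / \<rho> * (s p + V) * W p"
      using mult_right_mono[OF avg[OF that] W0] by (simp add: mult_ac)
    also have "\<dots> = 2 / \<rho> * (s p * W p + V * W p)"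
      by (simp only: distrib_right mult.assoc)
    \<comment> \<open>Each product uses the bound on \<open>W p\<close> that suits it,
      \<open>V\<close> next to \<open>s p\<close> and \<open>s p / \<rho>\<close> next to
      \<open>V\<close>, so that both become multiples of \<open>V * s p\<close>.\<close>
    also have "\<dots> \<le> 2 / \<rho> * (s p * V + V * (s p / \<rho>))"
      using rho_pos W1 W2 s V by (intro mult_left_mono add_mono) auto
    also have "\<dots> \<le> 2 / \<rho> * (V * (s p / \<rho>) + V * (s p / \<rho>))"
    proof -
      have "s p * \<rho> \<le> s p" using s[of p] rho_less by (simp add: mult_left_le)
      then have "s p \<le> s p / \<rho>" using rho_pos by (simp add: field_simps)
      then have "V * s p \<le> V * (s p / \<rho>)" using V by (rule mult_left_mono)
      then show ?thesis using rho_pos by (intro mult_left_mono) (auto simp: mult.commute)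
    qed
    also have "\<dots> = 4 / \<rho>\<^sup>2 * V * s p"
      by (simp add: power2_eq_square)
    finally show ?thesis .
  qed
  have "m * (\<Sum>p\<in>A. d p * W p) \<le> (\<Sum>p\<in>A. 4 / \<rho>\<^sup>2 * V * s p)"
    unfolding sum_distrib_left by (intro sum_mono point)
  also have "\<dots> = 4 / \<rho>\<^sup>2 * V * (\<Sum>p\<in>A. s p)"
    by (simp add: sum_distrib_left)
  also have "\<dots> \<le> 4 / \<rho>\<^sup>2 * V * (2 * m * (\<Sum>q\<in>A. (edist D q z)\<^sup>2))"
    unfolding s_def m_def using V by (intro mult_left_mono sum_pairs_edist_sq_le) auto
  also have "\<dots> = m * (V * (8 / \<rho>\<^sup>2 * (\<Sum>q\<in>A. (edist D q z)\<^sup>2)))"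
    by simp
  finally show ?thesis
    unfolding d_def W_def V_def using m by (rule mult_left_le_imp_le)
qed (simp add: ann_cost_def)

end

section \<open>The potential\<close>

text \<open>The map \<open>\<zeta>\<close> names the cluster of a data point by its reference
  center. It is later instantiated with a nearest center in \<open>Z\<close>, which turns the
  reference costs into \<open>cost D X Z\<close>.\<close>

locale clustered_seeding = ann_seeding +
  fixes Z :: "point set" and \<zeta> :: "point \<Rightarrow> point"
  assumes finZ: "finite Z" and zeta_in: "x \<in> X \<Longrightarrow> \<zeta> x \<in> Z"
begin

definition cl :: "point \<Rightarrow> point set"
  where "cl a = {x \<in> X. \<zeta> x = a}"

definition ref_cost :: "point \<Rightarrow> real"
  where "ref_cost a = 8 / \<rho>\<^sup>2 * (\<Sum>q\<in>cl a. (edist D q a)\<^sup>2)"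

text \<open>An empty cluster stays uncovered as long as centers are data points; it adds nothing to
  \<open>U\<close> and \<open>G\<close> but does count in \<open>card (unc cs)\<close>.\<close>

definition unc :: "point list \<Rightarrow> point set"
  where "unc cs = Z - \<zeta> ` set cs"

definition H :: "point list \<Rightarrow> real"
  where "H cs = (\<Sum>a\<in>Z - unc cs. ann_cost D L cs (cl a))"

definition U :: "point list \<Rightarrow> real"
  where "U cs = (\<Sum>a\<in>unc cs. ann_cost D L cs (cl a))"

definition G :: "point list \<Rightarrow> real"
  where "G cs = (\<Sum>a\<in>unc cs. ref_cost a)"

text \<open>The quotient is \<open>0\<close> when no cluster is uncovered; then \<open>U cs = 0\<close> as well.\<close>

definition \<Psi> :: "real \<Rightarrow> point list \<Rightarrow> real"
  where "\<Psi> r cs = (real (card (unc cs)) - r) / real (card (unc cs)) * U cs"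

lemma cl_sub: "cl a \<subseteq> X"
  by (auto simp: cl_def)

lemma finite_unc: "finite (unc cs)"
  using finZ by (simp add: unc_def)

lemma sum_clusters: "(\<Sum>a\<in>Z. \<Sum>x\<in>cl a. f x) = (\<Sum>x\<in>X. f x :: real)"
  unfolding cl_def by (rule sum.group) (use finX finZ zeta_in in auto)

lemma ref_cost_nonneg: "0 \<le> ref_cost a"
  by (simp add: ref_cost_def sum_nonneg)

lemma H_nonneg: "0 \<le> H cs"
  by (simp add: H_def ann_cost_nonneg sum_nonneg)

lemma U_nonneg: "0 \<le> U cs"
  by (simp add: U_def ann_cost_nonneg sum_nonneg)

lemma G_nonneg: "0 \<le> G cs"
  by (simp add: G_def ref_cost_nonneg sum_nonneg)

lemma H_plus_U: "H cs + U cs = ann_cost D L cs X"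
proof -
  have "ann_cost D L cs X = (\<Sum>a\<in>Z. ann_cost D L cs (cl a))"
    unfolding ann_cost_def by (rule sum_clusters[symmetric])
  also have "\<dots> = H cs + U cs"
    unfolding H_def U_def by (rule sum.subset_diff) (use finZ in \<open>auto simp: unc_def\<close>)
  finally show ?thesis by simp
qed

text \<open>Each center covers at most one cluster, so there are never fewer uncovered clusters than
  remaining steps. This keeps the coefficient in \<open>\<Psi>\<close> nonnegative.\<close>

lemma card_unc_ge:
  assumes "length cs + r = card Z"
  shows "r \<le> card (unc cs)"
proof -
  have "card (\<zeta> ` set cs) \<le> length cs"
    using card_image_le[of "set cs" \<zeta>] card_length[of cs] by simp
  moreover have "card Z - card (\<zeta> ` set cs) \<le> card (unc cs)"
    unfolding unc_def by (rule diff_card_le_card_Diff) simp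
  ultimately show ?thesis using assms by linarith
qed

section \<open>One sampling step: covered cost plus reference cost\<close>

lemma unc_snoc: "unc (cs @ [y]) = unc cs - {\<zeta> y}"
  by (auto simp: unc_def)

text \<open>A newly covered cluster trades its reference cost in \<open>G\<close> for its actual
  cost in \<open>H\<close>; clusters covered before only get cheaper, by monotonicity of the data
  structure.\<close>

lemma covered_plus_ref_snoc:
  assumes "cs \<noteq> []" "set cs \<subseteq> X" "y \<in> X"
  shows "H (cs @ [y]) + G (cs @ [y]) \<le> H cs + G cs +
    (if \<zeta> y \<in> unc cs then ann_cost D L (cs @ [y]) (cl (\<zeta> y)) - ref_cost (\<zeta> y) else 0)"
proof -
  have mono: "(\<Sum>a\<in>Z - unc cs. ann_cost D L (cs @ [y]) (cl a)) \<le> H cs"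
    unfolding H_def using assms cl_sub by (intro sum_mono ann_cost_snoc_le) auto
  show ?thesis
  proof (cases "\<zeta> y \<in> unc cs")
    case True
    have "Z - (unc cs - {\<zeta> y}) = insert (\<zeta> y) (Z - unc cs)"
      using True by (auto simp: unc_def)
    then have "H (cs @ [y]) = ann_cost D L (cs @ [y]) (cl (\<zeta> y))
        + (\<Sum>a\<in>Z - unc cs. ann_cost D L (cs @ [y]) (cl a))"
      using True finZ by (simp add: H_def unc_snoc)
    moreover have "G (cs @ [y]) = G cs - ref_cost (\<zeta> y)"
      using True finite_unc by (simp add: G_def unc_snoc sum_diff1)
    ultimately show ?thesis using mono True by simp
  next
    case False
    then show ?thesis using mono by (simp add: H_def G_def unc_snoc)
  qed
qed

lemma U_snoc:
  assumes "cs \<noteq> []" "set cs \<subseteq> X" "y \<in> X"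
  shows "U (cs @ [y]) \<le> U cs - (if \<zeta> y \<in> unc cs then ann_cost D L cs (cl (\<zeta> y)) else 0)"
proof -
  have "U (cs @ [y]) \<le> (\<Sum>a\<in>unc cs - {\<zeta> y}. ann_cost D L cs (cl a))"
    unfolding U_def unc_snoc using assms cl_sub by (intro sum_mono ann_cost_snoc_le) auto
  then show ?thesis
    using finite_unc[of cs] by (simp add: U_def sum_diff1 split: if_splits)
qed

text \<open>The weights \<open>w\<close> are kept abstract to fit both the uniform and the distance
  distribution. The last hypothesis says that, conditioned on a cluster being hit, its new cost is
  on average at most its reference cost, so every cluster contributes a nonpositive change.\<close>

lemma expected_covered_plus_ref:
  assumes "cs \<noteq> []" "set cs \<subseteq> X" "\<And>y. y \<in> X \<Longrightarrow> 0 \<le> w y" "(\<Sum>y\<in>X. w y) = 1"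
    and *: "\<And>a. a \<in> Z \<Longrightarrow> (\<Sum>y\<in>cl a. w y * ann_cost D L (cs @ [y]) (cl a))
      \<le> (\<Sum>y\<in>cl a. w y) * ref_cost a"
  shows "(\<Sum>y\<in>X. w y * (H (cs @ [y]) + G (cs @ [y]))) \<le> H cs + G cs"
proof -
  define g where "g y = (if \<zeta> y \<in> unc cs
    then ann_cost D L (cs @ [y]) (cl (\<zeta> y)) - ref_cost (\<zeta> y) else 0)" for y
  have "(\<Sum>y\<in>cl a. w y * g y) \<le> 0" if "a \<in> Z" for a
  proof (cases "a \<in> unc cs")
    case True
    then have "(\<Sum>y\<in>cl a. w y * g y)
        = (\<Sum>y\<in>cl a. w y * ann_cost D L (cs @ [y]) (cl a) - w y * ref_cost a)"
      by (intro sum.cong) (auto simp: g_def cl_def right_diff_distrib)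
    also have "\<dots> \<le> 0"
      using *[OF that] by (simp add: sum_subtractf sum_distrib_right)
    finally show ?thesis .
  next
    case False
    then have "(\<Sum>y\<in>cl a. w y * g y) = 0"
      by (intro sum.neutral) (auto simp: g_def cl_def)
    then show ?thesis by simp
  qed
  then have g: "(\<Sum>y\<in>X. w y * g y) \<le> 0"
    unfolding sum_clusters[symmetric] by (rule sum_nonpos)
  have "(\<Sum>y\<in>X. w y * (H (cs @ [y]) + G (cs @ [y]))) \<le> (\<Sum>y\<in>X. w y * (H cs + G cs + g y))"
    unfolding g_def using assms by (intro sum_mono mult_left_mono covered_plus_ref_snoc) auto
  also have "\<dots> = (\<Sum>y\<in>X. w y) * (H cs + G cs) + (\<Sum>y\<in>X. w y * g y)"
    by (simp add: distrib_left sum.distrib sum_distrib_right)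
  finally show ?thesis using g assms(4) by simp
qed

lemma expected_covered_plus_ref_uniform:
  assumes "cs \<noteq> []" "set cs \<subseteq> X"
  shows "(\<Sum>y\<in>X. 1 / real (card X) * (H (cs @ [y]) + G (cs @ [y]))) \<le> H cs + G cs"
proof (rule expected_covered_plus_ref[OF assms])
  show "(\<Sum>y\<in>X. 1 / real (card X)) = 1"
    using finX X_ne by simp
  fix a
  have "(\<Sum>y\<in>cl a. ann_cost D L (cs @ [y]) (cl a)) / real (card X)
      \<le> real (card (cl a)) * ref_cost a / real (card X)"
    unfolding ref_cost_def using assms cl_sub by (intro divide_right_mono sum_ann_cost_snoc_le) auto
  then show "(\<Sum>y\<in>cl a. 1 / real (card X) * ann_cost D L (cs @ [y]) (cl a))
      \<le> (\<Sum>y\<in>cl a. 1 / real (card X)) * ref_cost a"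
    by (simp add: sum_divide_distrib)
qed simp

lemma expected_covered_plus_ref_ann:
  assumes "cs \<noteq> []" "set cs \<subseteq> X"
  shows "(\<Sum>y\<in>X. ann_prob D L X cs y * (H (cs @ [y]) + G (cs @ [y]))) \<le> H cs + G cs"
proof (cases "ann_cost D L cs X = 0")
  case True
  then show ?thesis
    using expected_covered_plus_ref_uniform[OF assms] by (simp add: ann_prob_def)
next
  case False
  show ?thesis
  proof (rule expected_covered_plus_ref[OF assms ann_prob_nonneg sum_ann_prob[OF finX X_ne]])
    fix a
    have "(\<Sum>y\<in>cl a. ann_cost1 D L cs y * ann_cost D L (cs @ [y]) (cl a)) / ann_cost D L cs X
      \<le> ann_cost D L cs (cl a) * ref_cost a / ann_cost D L cs X"
      unfolding ref_cost_def using assms cl_sub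
      by (intro divide_right_mono sum_weighted_ann_cost_snoc_le ann_cost_nonneg) auto
    then show "(\<Sum>y\<in>cl a. ann_prob D L X cs y * ann_cost D L (cs @ [y]) (cl a))
      \<le> (\<Sum>y\<in>cl a. ann_prob D L X cs y) * ref_cost a"
      using False by (simp add: ann_prob_def ann_cost_def[of D L cs "cl a"]
          flip: sum_divide_distrib)
  qed
qed

section \<open>One sampling step: the middle term of the potential\<close>

lemma Psi_snoc:
  assumes "cs \<noteq> []" "set cs \<subseteq> X" "y \<in> X" "Suc r \<le> card (unc cs)"
  defines "u \<equiv> real (card (unc cs))"
  shows "\<Psi> (real r) (cs @ [y]) \<le> (if \<zeta> y \<in> unc cs
    then (u - real (Suc r)) / (u - 1) * (U cs - ann_cost D L cs (cl (\<zeta> y)))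
    else (u - real r) / u * U cs)"
proof (cases "\<zeta> y \<in> unc cs")
  case True
  \<comment> \<open>Both \<open>u\<close> and the step count drop by one, so the new numerator is
    \<open>(u - 1) - r\<close>, that is \<open>u - real (Suc r)\<close>. If \<open>u = 1\<close>
    then \<open>r = 0\<close>, and numerator and denominator are both 0.\<close>
  then have c: "real (card (unc (cs @ [y]))) = u - 1"
    using finite_unc assms(4) by (simp add: unc_snoc u_def card_Diff_singleton of_nat_diff)
  have "(u - real (Suc r)) / (u - 1) \<ge> 0"
    using assms(4) by (simp add: u_def)
  then have "(u - real (Suc r)) / (u - 1) * U (cs @ [y])
      \<le> (u - real (Suc r)) / (u - 1) * (U cs - ann_cost D L cs (cl (\<zeta> y)))"
    using U_snoc[OF assms(1-3)] True by (intro mult_left_mono) auto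
  then show ?thesis
    using True by (simp add: \<Psi>_def c algebra_simps)
next
  case False
  then have c: "real (card (unc (cs @ [y]))) = u"
    by (simp add: unc_snoc u_def)
  have "(u - real r) / u \<ge> 0"
    using assms(4) by (simp add: u_def)
  then have "(u - real r) / u * U (cs @ [y]) \<le> (u - real r) / u * U cs"
    using U_snoc[OF assms(1-3)] False by (intro mult_left_mono) auto
  then show ?thesis
    using False by (simp add: \<Psi>_def c)
qed

text \<open>A bound for every outcome \<open>y\<close>, as a uniform step requires: whichever
  cluster is hit, the coefficient of \<open>U\<close> grows by at most
  \<open>1 / real (Suc r)\<close>.\<close>

lemma Psi_snoc_le:
  assumes "cs \<noteq> []" "set cs \<subseteq> X" "y \<in> X" "Suc r \<le> card (unc cs)"
  shows "\<Psi> (real r) (cs @ [y]) \<le> \<Psi> (real (Suc r)) cs + ann_cost D L cs X / real (Suc r)"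
proof -
  define u where "u = real (card (unc cs))"
  define s where "s = real (Suc r)"
  have s: "0 < s" and su: "s \<le> u"
    using assms(4) by (simp_all add: u_def s_def)
  have UV: "U cs \<le> ann_cost D L cs X"
    using H_plus_U[of cs] H_nonneg[of cs] by simp
  have U: "U cs / s \<le> ann_cost D L cs X / s"
    using s UV by (intro divide_right_mono) auto
  show ?thesis
  proof (cases "\<zeta> y \<in> unc cs")
    case True
    have coef: "(u - s) / (u - 1) \<le> (u - s) / u + 1 / s"
    \<comment> \<open>With equality \<open>u - s\<close> is 0 and \<open>u - 1\<close> may be 0 too.
      Otherwise \<open>u - 1 \<ge> s\<close>, and the difference of the reciprocals of
      \<open>u - 1\<close> and \<open>u\<close> is \<open>1 / (u * (u - 1))\<close>.\<close>
    proof (cases "card (unc cs) = Suc r")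
      case True
      then show ?thesis by (simp add: u_def s_def)
    next
      case False
      then have "u - 1 \<ge> s"
        using assms(4) by (simp add: u_def s_def)
      then have "(u - s) / (u - 1) - (u - s) / u = (u - s) / u * (1 / (u - 1))"
        using s su by (simp add: field_simps)
      also have "\<dots> \<le> 1 * (1 / s)"
        using s su \<open>u - 1 \<ge> s\<close> by (intro mult_mono divide_left_mono) auto
      finally show ?thesis by simp
    qed
    have "\<Psi> (real r) (cs @ [y]) \<le> (u - s) / (u - 1) * (U cs - ann_cost D L cs (cl (\<zeta> y)))"
      using Psi_snoc[OF assms] True by (simp add: u_def s_def)
    also have "\<dots> \<le> (u - s) / (u - 1) * U cs"
      using s su by (intro mult_left_mono) (auto simp: ann_cost_nonneg s_def)
    also have "\<dots> \<le> ((u - s) / u + 1 / s) * U cs"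
      by (intro mult_right_mono coef U_nonneg)
    also have "\<dots> = \<Psi> s cs + U cs / s"
      by (simp add: \<Psi>_def u_def distrib_right)
    finally show ?thesis using U by (simp add: s_def)
  next
    case False
    then have "\<Psi> (real r) (cs @ [y]) \<le> (u - (s - 1)) / u * U cs"
      using Psi_snoc[OF assms] by (simp add: u_def s_def)
    also have "\<dots> = \<Psi> s cs + U cs / u"
      by (simp add: \<Psi>_def u_def diff_divide_distrib add_divide_distrib algebra_simps)
    also have "\<dots> \<le> \<Psi> s cs + U cs / s"
      using s su U_nonneg by (intro add_left_mono divide_left_mono) auto
    finally show ?thesis using U by (simp add: s_def)
  qed
qed

text \<open>Cluster \<open>a\<close> is hit with probability \<open>v a / V\<close>. Hits on
  uncovered clusters favor the expensive ones, and the resulting drop of \<open>U\<close> pays for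
  the larger coefficient. What remains is a hit on a covered cluster, of probability
  \<open>H cs / V\<close>, which wastes a step at the price \<open>U cs / u\<close>.\<close>

lemma expected_Psi_ann:
  assumes "cs \<noteq> []" "set cs \<subseteq> X" "Suc r \<le> card (unc cs)" "ann_cost D L cs X \<noteq> 0"
  shows "(\<Sum>y\<in>X. ann_prob D L X cs y * \<Psi> (real r) (cs @ [y]))
    \<le> \<Psi> (real (Suc r)) cs + H cs / real (Suc r)"
proof -
  define u where "u = real (card (unc cs))"
  define s where "s = real (Suc r)"
  define V where "V = ann_cost D L cs X"
  define v where "v a = ann_cost D L cs (cl a)" for a
  define t where "t a = (if a \<in> unc cs then (u - s) / (u - 1) * (U cs - v a)
    else (u - (s - 1)) / u * U cs)" for a
  have s: "0 < s" "1 \<le> s" and su: "s \<le> u"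
    using assms(3) by (simp_all add: u_def s_def)
  have V: "V > 0"
    using assms(4) ann_cost_nonneg[of D L cs X] by (simp add: V_def)
  have HU: "H cs + U cs = V" by (simp add: H_plus_U V_def)
  have Uv: "U cs = (\<Sum>a\<in>unc cs. v a)" by (simp add: U_def v_def)
  have uncovered: "(\<Sum>a\<in>unc cs. v a * t a) \<le> (u - s) / u * (U cs)\<^sup>2"
  proof -
    \<comment> \<open>Cauchy-Schwarz against the constant 1: on average a hit removes at least the
      mean uncovered cost.\<close>
    have cs_ineq: "(U cs)\<^sup>2 / u \<le> (\<Sum>a\<in>unc cs. (v a)\<^sup>2)"
    proof -
      have "(U cs)\<^sup>2 \<le> u * (\<Sum>a\<in>unc cs. (v a)\<^sup>2)"
        using Cauchy_Schwarz_ineq_sum[of v "\<lambda>_. 1" "unc cs"] by (simp add: Uv u_def mult.commute)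
      then show ?thesis using s su by (simp add: field_simps)
    qed
    have "(\<Sum>a\<in>unc cs. v a * t a) = (\<Sum>a\<in>unc cs. (u - s) / (u - 1) * (U cs * v a - (v a)\<^sup>2))"
      by (intro sum.cong) (auto simp: t_def power2_eq_square algebra_simps)
    also have "\<dots> = (u - s) / (u - 1) * ((U cs)\<^sup>2 - (\<Sum>a\<in>unc cs. (v a)\<^sup>2))"
      unfolding sum_distrib_left[symmetric] sum_subtractf Uv[symmetric] power2_eq_square ..
    also have "\<dots> \<le> (u - s) / (u - 1) * ((U cs)\<^sup>2 - (U cs)\<^sup>2 / u)"
      using s su cs_ineq by (intro mult_left_mono) auto
    also have "\<dots> = (u - s) / u * (U cs)\<^sup>2"
    \<comment> \<open>At \<open>u = 1\<close> also \<open>s = 1\<close>, and both sides are 0;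
      otherwise \<open>u - 1\<close> cancels.\<close>
    proof (cases "u = 1")
      case True
      then have "s = 1" using s su by simp
      with True show ?thesis by simp
    next
      case False
      then have "u - 1 \<noteq> 0" "u \<noteq> 0" using s su by auto
      then show ?thesis by (simp add: divide_simps) (simp add: algebra_simps)
    qed
    finally show ?thesis .
  qed
  have covered: "(\<Sum>a\<in>Z - unc cs. v a * t a) = H cs * ((u - (s - 1)) / u * U cs)"
    by (simp add: t_def H_def v_def sum_distrib_right sum_divide_distrib)
  have "(\<Sum>y\<in>X. ann_prob D L X cs y * \<Psi> (real r) (cs @ [y]))
      \<le> (\<Sum>y\<in>X. ann_prob D L X cs y * t (\<zeta> y))"
  proof (intro sum_mono mult_left_mono ann_prob_nonneg)
    fix y assume "y \<in> X"
    from Psi_snoc[OF assms(1,2) this assms(3)] show "\<Psi> (real r) (cs @ [y]) \<le> t (\<zeta> y)"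
      by (simp add: t_def u_def s_def v_def split: if_splits)
  qed
  also have "\<dots> = (\<Sum>a\<in>Z. \<Sum>y\<in>cl a. ann_cost1 D L cs y / V * t (\<zeta> y))"
    using assms(4) by (simp add: sum_clusters ann_prob_def V_def)
  also have "\<dots> = (\<Sum>a\<in>Z. v a * t a / V)"
    unfolding v_def ann_cost_def
    by (intro sum.cong) (auto simp: cl_def sum_distrib_right sum_divide_distrib)
  also have "\<dots> = ((\<Sum>a\<in>Z - unc cs. v a * t a) + (\<Sum>a\<in>unc cs. v a * t a)) / V"
    unfolding sum_divide_distrib[symmetric]
    by (subst sum.subset_diff[of "unc cs" Z]) (use finZ in \<open>auto simp: unc_def\<close>)
  also have "\<dots> \<le> (H cs * ((u - (s - 1)) / u * U cs) + (u - s) / u * (U cs)\<^sup>2) / V"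
    using uncovered covered V by (intro divide_right_mono add_mono) auto
  also have "\<dots> = ((u - s) / u * U cs * (H cs + U cs) + H cs * U cs / u) / V"
  proof -
    have "(u - (s - 1)) / u = (u - s) / u + 1 / u"
      by (simp flip: add_divide_distrib)
    then show ?thesis
      by (simp add: algebra_simps power2_eq_square add_divide_distrib diff_divide_distrib)
  qed
  also have "\<dots> = \<Psi> s cs + H cs / u * (U cs / V)"
    using V unfolding HU by (simp add: \<Psi>_def u_def add_divide_distrib)
  also have "\<dots> \<le> \<Psi> s cs + H cs / s * 1"
    using s su V HU H_nonneg[of cs] U_nonneg[of cs]
    by (intro add_left_mono mult_mono divide_left_mono) auto
  finally show ?thesis by (simp add: s_def)
qed

section \<open>The supermartingale property\<close>

definition F :: "real \<Rightarrow> nat \<Rightarrow> point list \<Rightarrow> real"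
  where "F \<delta> r cs = (1 + harm r) * (H cs + G cs) + \<Psi> (real r) cs + \<delta> * harm r * ann_cost D L cs X"

text \<open>The increase of the harmonic number by \<open>1 / s\<close> pays for both rises of the
  middle term: in the first summand of \<open>F\<close> for \<open>H cs / s\<close>, in the last for
  \<open>\<delta> * V / s\<close>. The surplus \<open>G cs / s\<close> is slack.\<close>

lemma F_step:
  assumes "cs \<noteq> []" "set cs \<subseteq> X" "Suc r \<le> card (unc cs)" "0 \<le> \<delta>" "\<delta> \<le> 1"
  shows "(\<Sum>y\<in>X. mixed_prob D \<delta> L X cs y * F \<delta> r (cs @ [y])) \<le> F \<delta> (Suc r) cs"
proof -
  define V where "V = ann_cost D L cs X"
  define s where "s = real (Suc r)"
  have s: "s > 0" by (simp add: s_def)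
  have V: "V \<ge> 0" by (simp add: V_def ann_cost_nonneg)
  have h: "harm r \<ge> (0::real)" by (rule harm_nonneg)
  have hS: "harm (Suc r) = harm r + 1 / s"
    by (simp add: harm_Suc s_def inverse_eq_divide)
  \<comment> \<open>This is \<open>F \<delta> (Suc r) cs\<close> with the harmonic number of the
    next state, hence what is left before the rises are charged.\<close>
  define B where "B = (1 + harm r) * (H cs + G cs) + \<Psi> s cs + \<delta> * harm r * V"
  have split: "(\<Sum>y\<in>X. w y * F \<delta> r (cs @ [y])) \<le> B + e"
    if w: "\<And>y. y \<in> X \<Longrightarrow> 0 \<le> w y" "(\<Sum>y\<in>X. w y) = 1"
      and HG: "(\<Sum>y\<in>X. w y * (H (cs @ [y]) + G (cs @ [y]))) \<le> H cs + G cs"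
      and P: "(\<Sum>y\<in>X. w y * \<Psi> (real r) (cs @ [y])) \<le> \<Psi> s cs + e" for w e
  proof -
    have "(\<Sum>y\<in>X. w y * ann_cost D L (cs @ [y]) X) \<le> (\<Sum>y\<in>X. w y * V)"
      unfolding V_def using assms w by (intro sum_mono mult_left_mono ann_cost_snoc_le) auto
    then have Vw: "(\<Sum>y\<in>X. w y * ann_cost D L (cs @ [y]) X) \<le> V"
      using w by (simp flip: sum_distrib_right)
    have "(\<Sum>y\<in>X. w y * F \<delta> r (cs @ [y]))
      = (1 + harm r) * (\<Sum>y\<in>X. w y * (H (cs @ [y]) + G (cs @ [y])))
        + (\<Sum>y\<in>X. w y * \<Psi> (real r) (cs @ [y]))
        + \<delta> * harm r * (\<Sum>y\<in>X. w y * ann_cost D L (cs @ [y]) X)"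
      unfolding F_def sum_distrib_left sum.distrib[symmetric]
      by (intro sum.cong) (auto simp: algebra_simps)
    also have "\<dots> \<le> (1 + harm r) * (H cs + G cs) + (\<Psi> s cs + e) + \<delta> * harm r * V"
      using HG P Vw h assms(4) by (intro add_mono mult_left_mono) auto
    finally show ?thesis by (simp add: B_def)
  qed
  have card: "(\<Sum>y\<in>X. 1 / real (card X)) = 1"
    using finX X_ne by simp
  have Punif: "(\<Sum>y\<in>X. 1 / real (card X) * \<Psi> (real r) (cs @ [y])) \<le> \<Psi> s cs + V / s"
  proof -
    have "(\<Sum>y\<in>X. 1 / real (card X) * \<Psi> (real r) (cs @ [y]))
        \<le> (\<Sum>y\<in>X. 1 / real (card X) * (\<Psi> s cs + V / s))"
      unfolding V_def s_def using assms by (intro sum_mono mult_left_mono Psi_snoc_le) auto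
    also have "\<dots> = \<Psi> s cs + V / s"
      unfolding sum_distrib_right[symmetric] card by simp
    finally show ?thesis .
  qed
  have unif: "(\<Sum>y\<in>X. 1 / real (card X) * F \<delta> r (cs @ [y])) \<le> B + V / s"
    by (rule split[OF _ card expected_covered_plus_ref_uniform[OF assms(1,2)] Punif]) simp
  \<comment> \<open>At total cost 0 the distance distribution is uniform by convention, and
    \<open>H cs\<close> and \<open>V\<close> are both 0, so the uniform bound suffices.\<close>
  have Pann: "(\<Sum>y\<in>X. ann_prob D L X cs y * \<Psi> (real r) (cs @ [y])) \<le> \<Psi> s cs + H cs / s"
  proof (cases "V = 0")
    case True
    then have "H cs = 0"
      using H_plus_U[of cs] H_nonneg[of cs] U_nonneg[of cs] by (simp add: V_def)
    then show ?thesis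
      using Punif True by (simp add: ann_prob_def V_def)
  next
    case False
    then show ?thesis
      using expected_Psi_ann[OF assms(1-3)] by (simp add: V_def s_def)
  qed
  have annb: "(\<Sum>y\<in>X. ann_prob D L X cs y * F \<delta> r (cs @ [y])) \<le> B + H cs / s"
    by (rule split[OF ann_prob_nonneg sum_ann_prob[OF finX X_ne]
          expected_covered_plus_ref_ann[OF assms(1,2)] Pann])
  have "(\<Sum>y\<in>X. mixed_prob D \<delta> L X cs y * F \<delta> r (cs @ [y]))
    = (1 - \<delta>) * (\<Sum>y\<in>X. ann_prob D L X cs y * F \<delta> r (cs @ [y]))
      + \<delta> * (\<Sum>y\<in>X. 1 / real (card X) * F \<delta> r (cs @ [y]))"
    unfolding sum_distrib_left sum.distrib[symmetric]
    by (intro sum.cong) (auto simp: mixed_prob_def algebra_simps)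
  also have "\<dots> \<le> (1 - \<delta>) * (B + H cs / s) + \<delta> * (B + V / s)"
    using annb unif assms by (intro add_mono mult_left_mono) auto
  also have "\<dots> = B + (1 - \<delta>) * (H cs / s) + \<delta> * (V / s)"
    by (simp add: algebra_simps)
  also have "\<dots> \<le> B + (H cs + G cs) / s + \<delta> * (V / s)"
  proof -
    have "(1 - \<delta>) * (H cs / s) \<le> 1 * (H cs / s)"
      using assms s H_nonneg[of cs] by (intro mult_right_mono) auto
    also have "\<dots> \<le> (H cs + G cs) / s"
      using s G_nonneg[of cs] by (simp add: divide_right_mono)
    finally show ?thesis by simp
  qed
  also have "\<dots> = F \<delta> (Suc r) cs"
    unfolding F_def hS B_def V_def s_def[symmetric]
    by (simp add: algebra_simps add_divide_distrib)
  finally show ?thesis .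
qed

text \<open>With no step remaining, \<open>harm 0\<close> is 0 and \<open>\<Psi>\<close> is all of
  \<open>U\<close>, so the potential is the full data-structure cost plus \<open>G\<close>.\<close>

lemma cost_le_F_zero:
  assumes "cs \<noteq> []" "set cs \<subseteq> X"
  shows "cost D X (set cs) \<le> F \<delta> 0 cs"
proof -
  have "\<Psi> 0 cs = U cs"
    using finite_unc[of cs] by (cases "unc cs = {}") (auto simp: \<Psi>_def U_def card_gt_0_iff)
  then have "F \<delta> 0 cs = ann_cost D L cs X + G cs"
    using H_plus_U[of cs] by (simp add: F_def harm_def)
  then show ?thesis
    using cost_le_ann_cost[OF assms] G_nonneg[of cs] by simp
qed

text \<open>The first center covers exactly one of \<open>Suc r\<close> clusters, leaving
  \<open>r\<close>, so the middle term is 0. Since that center is uniform, the pair bounds control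
  the cost of its cluster and the total cost.\<close>

lemma F_init:
  assumes "card Z = Suc r" "0 \<le> \<delta>"
  shows "(\<Sum>c\<in>X. 1 / real (card X) * F \<delta> r [c])
    \<le> (1 + harm r) * (\<Sum>a\<in>Z. ref_cost a) + \<delta> * harm r * (2 * (\<Sum>q\<in>X. (edist D q z)\<^sup>2))"
proof -
  define n where "n = real (card X)"
  have n: "n > 0" using finX X_ne by (simp add: n_def card_gt_0_iff)
  have h: "harm r \<ge> (0::real)" by (rule harm_nonneg)
  have Psi: "\<Psi> (real r) [c] = 0" if "c \<in> X" for c
    using zeta_in[OF that] finZ assms by (simp add: \<Psi>_def unc_def)
  have HG: "H [c] + G [c] = (\<Sum>a\<in>Z. ref_cost a)
      + (ann_cost D L [c] (cl (\<zeta> c)) - ref_cost (\<zeta> c))" if "c \<in> X" for c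
  proof -
    have "Z - (Z - {\<zeta> c}) = {\<zeta> c}" using zeta_in[OF that] by auto
    then show ?thesis
      using zeta_in[OF that] finZ by (simp add: H_def G_def unc_def sum_diff1)
  qed
  have "(\<Sum>c\<in>X. ann_cost D L [c] (cl (\<zeta> c)) - ref_cost (\<zeta> c)) \<le> 0"
    unfolding sum_clusters[symmetric]
  proof (rule sum_nonpos)
    fix a
    have "(\<Sum>c\<in>cl a. ann_cost D L [c] (cl (\<zeta> c)) - ref_cost (\<zeta> c))
        = (\<Sum>c\<in>cl a. ann_cost D L ([] @ [c]) (cl a)) - real (card (cl a)) * ref_cost a"
    proof -
      have "(\<Sum>c\<in>cl a. ann_cost D L [c] (cl (\<zeta> c)) - ref_cost (\<zeta> c))
          = (\<Sum>c\<in>cl a. ann_cost D L [c] (cl a) - ref_cost a)"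
        by (intro sum.cong) (auto simp: cl_def)
      then show ?thesis by (simp add: sum_subtractf)
    qed
    also have "\<dots> \<le> 0"
      using sum_ann_cost_snoc_le[of "[]" "cl a" a] cl_sub by (simp add: ref_cost_def)
    finally show "(\<Sum>c\<in>cl a. ann_cost D L [c] (cl (\<zeta> c)) - ref_cost (\<zeta> c)) \<le> 0" .
  qed
  then have HGs: "(\<Sum>c\<in>X. H [c] + G [c]) \<le> n * (\<Sum>a\<in>Z. ref_cost a)"
    by (simp add: HG sum.distrib n_def)
  have "(\<Sum>c\<in>X. ann_cost D L [c] X) = (\<Sum>c\<in>X. \<Sum>q\<in>X. (edist D q c)\<^sup>2)"
    unfolding ann_cost_def
  proof (intro sum.cong refl)
    fix c q assume "c \<in> X" "q \<in> X"
    \<comment> \<open>With a single center the query is exact, so no factor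
      \<open>1 / \<rho>\<close> enters the term with \<open>\<delta>\<close>.\<close>
    then have "L [c] q = c" using query_in[of "[c]" q] by simp
    then show "ann_cost1 D L [c] q = (edist D q c)\<^sup>2" by (simp add: ann_cost1_def)
  qed
  also have "\<dots> \<le> 2 * n * (\<Sum>q\<in>X. (edist D q z)\<^sup>2)"
    unfolding n_def by (rule sum_pairs_edist_sq_le)
  finally have Vs: "(\<Sum>c\<in>X. ann_cost D L [c] X) \<le> n * (2 * (\<Sum>q\<in>X. (edist D q z)\<^sup>2))"
    by simp
  have "(\<Sum>c\<in>X. 1 / n * F \<delta> r [c])
    = ((1 + harm r) * (\<Sum>c\<in>X. H [c] + G [c]) + \<delta> * harm r * (\<Sum>c\<in>X. ann_cost D L [c] X)) / n"
    by (simp add: F_def Psi sum.distrib flip: sum_divide_distrib sum_distrib_left)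
  also have "\<dots> \<le> ((1 + harm r) * (n * (\<Sum>a\<in>Z. ref_cost a))
      + \<delta> * harm r * (n * (2 * (\<Sum>q\<in>X. (edist D q z)\<^sup>2)))) / n"
    using HGs Vs n h assms(2) by (intro divide_right_mono add_mono mult_left_mono) auto
  also have "\<dots> = (1 + harm r) * (\<Sum>a\<in>Z. ref_cost a)
      + \<delta> * harm r * (2 * (\<Sum>q\<in>X. (edist D q z)\<^sup>2))"
    using n by (simp add: field_simps)
  finally show ?thesis by (simp add: n_def)
qed

section \<open>The expected cost\<close>

lemma set_next_center:
  assumes "0 \<le> \<delta>" "\<delta> \<le> 1"
  shows "set_pmf (next_center D \<delta> L X cs) \<subseteq> X"
  by (auto simp: set_pmf_eq pmf_next_center[OF finX X_ne assms] mixed_prob_def split: if_splits)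

lemma set_center_seq:
  assumes "0 \<le> \<delta>" "\<delta> \<le> 1"
  shows "set_pmf (center_seq D \<delta> L X (Suc j)) \<subseteq> {cs. set cs \<subseteq> X \<and> length cs = Suc j}"
proof (induction j)
  case 0
  then show ?case using finX X_ne by (auto simp: center_seq_def)
next
  case (Suc j)
  then show ?case using set_next_center[OF assms]
    by (fastforce simp: center_seq_def add_center_def)
qed

text \<open>Induction on the steps taken, with \<open>r\<close> general: removing the last step
  replaces \<open>F \<delta> r\<close> by \<open>F \<delta> (Suc r)\<close>. All supports are
  finite, so expectations become finite sums.\<close>

lemma expected_F_center_seq:
  assumes "0 \<le> \<delta>" "\<delta> \<le> 1" "Suc (j + r) = card Z"
  shows "measure_pmf.expectation (center_seq D \<delta> L X (Suc j)) (F \<delta> r)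
    \<le> (\<Sum>c\<in>X. 1 / real (card X) * F \<delta> (j + r) [c])"
  using assms(3)
proof (induction j arbitrary: r)
  case 0
  then show ?case
    using finX X_ne by (simp add: center_seq_def integral_pmf_of_set sum_divide_distrib)
next
  case (Suc j)
  define S where "S = {cs. set cs \<subseteq> X \<and> length cs = Suc j}"
  have finS: "finite S"
    unfolding S_def by (rule finite_lists_length_eq[OF finX])
  have sub: "set_pmf (center_seq D \<delta> L X (Suc j)) \<subseteq> S"
    unfolding S_def by (rule set_center_seq[OF assms(1,2)])
  have step: "measure_pmf.expectation (add_center D \<delta> L X cs) (F \<delta> r) \<le> F \<delta> (Suc r) cs"
    if "cs \<in> S" for cs
  proof -
    have "Suc r \<le> card (unc cs)"
      using that Suc.prems by (intro card_unc_ge) (auto simp: S_def)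
    moreover have "measure_pmf.expectation (add_center D \<delta> L X cs) (F \<delta> r)
        = (\<Sum>y\<in>X. mixed_prob D \<delta> L X cs y * F \<delta> r (cs @ [y]))"
      unfolding add_center_def integral_map_pmf
      using set_next_center[OF assms(1,2)]
      by (subst integral_measure_pmf[OF finX])
        (auto simp: pmf_next_center[OF finX X_ne assms(1,2)])
    moreover have "cs \<noteq> []" "set cs \<subseteq> X"
      using that by (auto simp: S_def)
    ultimately show ?thesis
      using F_step[of cs r \<delta>] assms by simp
  qed
  have "measure_pmf.expectation (center_seq D \<delta> L X (Suc (Suc j))) (F \<delta> r)
      = measure_pmf.expectation (center_seq D \<delta> L X (Suc j) \<bind> add_center D \<delta> L X) (F \<delta> r)"
    by (simp add: center_seq_def)
  also have "\<dots> = (\<Sum>cs\<in>S. pmf (center_seq D \<delta> L X (Suc j)) cs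
      *\<^sub>R measure_pmf.expectation (add_center D \<delta> L X cs) (F \<delta> r))"
    using finite_subset[OF set_next_center[OF assms(1,2)] finX]
    by (intro pmf_expectation_bind[OF finS _ sub]) (simp add: add_center_def)
  also have "\<dots> \<le> (\<Sum>cs\<in>S. pmf (center_seq D \<delta> L X (Suc j)) cs *\<^sub>R F \<delta> (Suc r) cs)"
    by (intro sum_mono scaleR_left_mono step) auto
  also have "\<dots> = measure_pmf.expectation (center_seq D \<delta> L X (Suc j)) (F \<delta> (Suc r))"
    using sub by (intro integral_measure_pmf[OF finS, symmetric]) auto
  also have "\<dots> \<le> (\<Sum>c\<in>X. 1 / real (card X) * F \<delta> (Suc j + r) [c])"
    using Suc.IH[of "Suc r"] Suc.prems by simp
  finally show ?case .
qed

lemma expected_cost_le: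
  assumes "0 \<le> \<delta>" "\<delta> \<le> 1" "card Z = Suc r"
  shows "measure_pmf.expectation (kmeanspp D \<delta> L X (Suc r)) (cost D X)
    \<le> (1 + harm r) * (\<Sum>a\<in>Z. ref_cost a) + \<delta> * harm r * (2 * (\<Sum>q\<in>X. (edist D q z)\<^sup>2))"
proof -
  have supp: "set_pmf (center_seq D \<delta> L X (Suc r)) \<subseteq> {cs. set cs \<subseteq> X \<and> length cs = Suc r}"
    by (rule set_center_seq[OF assms(1,2)])
  then have fin: "finite (set_pmf (center_seq D \<delta> L X (Suc r)))"
    using finite_lists_length_eq[OF finX] by (rule finite_subset)
  have "measure_pmf.expectation (kmeanspp D \<delta> L X (Suc r)) (cost D X)
      = measure_pmf.expectation (center_seq D \<delta> L X (Suc r)) (\<lambda>cs. cost D X (set cs))"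
    by (simp add: kmeanspp_def)
  also have "\<dots> \<le> measure_pmf.expectation (center_seq D \<delta> L X (Suc r)) (F \<delta> 0)"
  proof (intro integral_mono_AE integrable_measure_pmf_finite fin AE_pmfI)
    fix cs assume "cs \<in> set_pmf (center_seq D \<delta> L X (Suc r))"
    then have "cs \<noteq> []" "set cs \<subseteq> X" using supp by auto
    then show "cost D X (set cs) \<le> F \<delta> 0 cs" by (rule cost_le_F_zero)
  qed
  also have "\<dots> \<le> (\<Sum>c\<in>X. 1 / real (card X) * F \<delta> r [c])"
    using expected_F_center_seq[OF assms(1,2), of r 0] assms(3) by simp
  also have "\<dots> \<le> (1 + harm r) * (\<Sum>a\<in>Z. ref_cost a)
      + \<delta> * harm r * (2 * (\<Sum>q\<in>X. (edist D q z)\<^sup>2))"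
    using assms by (intro F_init)
  finally show ?thesis .
qed

end

text \<open>Assigning every point to a nearest center in \<open>Z\<close> makes the reference costs
  add up to a multiple of \<open>cost D X Z\<close>. The point \<open>z\<close> is independent of
  \<open>Z\<close>, so the two terms can be minimized separately.\<close>

lemma (in ann_seeding) expected_cost_le_reference:
  assumes "0 \<le> \<delta>" "\<delta> \<le> 1" "finite Z" "card Z = Suc r"
  shows "measure_pmf.expectation (kmeanspp D \<delta> L X (Suc r)) (cost D X)
    \<le> (1 + harm r) * (8 / \<rho>\<^sup>2) * cost D X Z + \<delta> * harm r * 2 * cost D X {z}"
proof -
  have Z: "Z \<noteq> {}" using assms by auto
  have "\<exists>c\<in>Z. (edist D x c)\<^sup>2 = Min ((\<lambda>c. (edist D x c)\<^sup>2) ` Z)" for x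
    using Min_in[of "(\<lambda>c. (edist D x c)\<^sup>2) ` Z"] assms(3) Z by fastforce
  then obtain \<zeta> where \<zeta>: "\<And>x. \<zeta> x \<in> Z"
    "\<And>x. (edist D x (\<zeta> x))\<^sup>2 = Min ((\<lambda>c. (edist D x c)\<^sup>2) ` Z)"
    by metis
  interpret clustered_seeding D X \<rho> L Z \<zeta>
    by unfold_locales (use assms \<zeta> in auto)
  have "(\<Sum>a\<in>Z. ref_cost a) = 8 / \<rho>\<^sup>2 * (\<Sum>a\<in>Z. \<Sum>q\<in>cl a. (edist D q (\<zeta> q))\<^sup>2)"
    unfolding ref_cost_def sum_distrib_left[symmetric]
    by (intro arg_cong2[where f = "(*)"] sum.cong refl) (auto simp: cl_def)
  also have "\<dots> = 8 / \<rho>\<^sup>2 * cost D X Z"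
    unfolding sum_clusters by (simp add: cost_def \<zeta>)
  finally have "(\<Sum>a\<in>Z. ref_cost a) = 8 / \<rho>\<^sup>2 * cost D X Z" .
  moreover have "cost D X {z} = (\<Sum>q\<in>X. (edist D q z)\<^sup>2)"
    by (simp add: cost_def)
  ultimately show ?thesis
    using expected_cost_le[OF assms(1,2,4), of z] by (simp only: mult.assoc)
qed

section \<open>Optimal costs\<close>

text \<open>Provides center sets of every cardinality, so that the infimum in \<open>opt\<close>
  ranges over a nonempty family.\<close>

lemma infinite_Euclidean_carrier:
  assumes "D \<ge> 1"
  shows "infinite (R D)"
proof -
  define f :: "real \<Rightarrow> point" where "f t = (\<lambda>i. if i = 0 then t else 0)" for t
  have "inj f" by (rule injI) (metis f_def)
  then have "infinite (range f)"
    using finite_imageD infinite_UNIV_char_0 by blast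
  moreover have "range f \<subseteq> R D"
    using assms by (auto simp: f_def topspace_Euclidean_space)
  ultimately show ?thesis using finite_subset by blast
qed

text \<open>Passes a bound valid for all center sets to the infimum. The case
  \<open>\<alpha> = 0\<close> is separate because the argument divides by
  \<open>\<alpha>\<close>.\<close>

lemma le_affine_opt:
  assumes "D \<ge> 1" "0 \<le> \<alpha>"
    and "\<And>C. C \<subseteq> R D \<Longrightarrow> finite C \<Longrightarrow> card C = k \<Longrightarrow> e \<le> \<alpha> * cost D X C + b"
  shows "e \<le> \<alpha> * opt D k X + b"
proof -
  obtain C0 where C0: "C0 \<subseteq> R D" "finite C0" "card C0 = k"
    using infinite_arbitrarily_large[OF infinite_Euclidean_carrier[OF assms(1)]] by metis
  show ?thesis
  proof (cases "\<alpha> = 0")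
    case True
    then show ?thesis using assms(3)[OF C0] by simp
  next
    case False
    then have \<alpha>: "\<alpha> > 0" using assms(2) by simp
    have "(e - b) / \<alpha> \<le> opt D k X"
      unfolding opt_def
    proof (rule cINF_greatest)
      show "{C. C \<subseteq> R D \<and> finite C \<and> card C = k} \<noteq> {}" using C0 by blast
      fix C assume "C \<in> {C. C \<subseteq> R D \<and> finite C \<and> card C = k}"
      then have "e \<le> \<alpha> * cost D X C + b" using assms(3) by blast
      then show "(e - b) / \<alpha> \<le> cost D X C" using \<alpha> by (simp add: field_simps)
    qed
    then show ?thesis using \<alpha> by (simp add: field_simps)
  qed
qed

lemma opt_nonneg:
  assumes "D \<ge> 1" "k \<ge> 1"
  shows "0 \<le> opt D k X"
proof -
  have "0 \<le> cost D X C" if "finite C" "card C = k" for C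
  proof -
    \<comment> \<open>Here \<open>k \<ge> 1\<close> matters: \<open>Min\<close> is only meaningful
      on a nonempty set.\<close>
    have "C \<noteq> {}" using that assms(2) by auto
    then show ?thesis
      unfolding cost_def using that by (intro sum_nonneg) auto
  qed
  then show ?thesis
    using le_affine_opt[OF assms(1), of 1 k 0 X 0] by simp
qed

lemma (in ann_seeding) expected_cost_le_opt:
  assumes "D \<ge> 1" "0 \<le> \<delta>" "\<delta> \<le> 1"
  shows "measure_pmf.expectation (kmeanspp D \<delta> L X (Suc r)) (cost D X)
    \<le> (1 + harm r) * (8 / \<rho>\<^sup>2) * opt D (Suc r) X + \<delta> * harm r * 2 * opt D 1 X"
proof (rule le_affine_opt[OF assms(1)])
  have h: "harm r \<ge> (0::real)" by (rule harm_nonneg)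
  then show "0 \<le> (1 + harm r) * (8 / \<rho>\<^sup>2)" by simp
  fix Z assume Z: "Z \<subseteq> R D" "finite Z" "card Z = Suc r"
  let ?e = "measure_pmf.expectation (kmeanspp D \<delta> L X (Suc r)) (cost D X)"
  let ?b = "(1 + harm r) * (8 / \<rho>\<^sup>2) * cost D X Z"
  \<comment> \<open>The infimum over single centers is taken first, with \<open>Z\<close> fixed; the
    enclosing step then takes the infimum over \<open>Z\<close>.\<close>
  have "?e \<le> \<delta> * harm r * 2 * opt D 1 X + ?b"
  proof (rule le_affine_opt[OF assms(1)])
    show "0 \<le> \<delta> * harm r * 2" using h assms by simp
    fix C :: "point set" assume "card C = 1"
    then obtain z where "C = {z}" using card_1_singletonE by blast
    then show "?e \<le> \<delta> * harm r * 2 * cost D X C + ?b"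
      using expected_cost_le_reference[OF assms(2,3) Z(2,3), of z] by simp
  qed
  then show "?e \<le> ?b + \<delta> * harm r * 2 * opt D 1 X" by simp
qed

text \<open>The difference between \<open>harm n\<close> and \<open>ln n\<close> decreases in
  \<open>n\<close> and equals 1 at \<open>n = 1\<close>.\<close>

lemma harm_le_one_plus_ln:
  assumes "n \<ge> 1"
  shows "harm n \<le> 1 + ln (real n)"
  using euler_mascheroni_sequence_decreasing[of 1 n] assms by (simp add: harm_def)

theorem mainTheorem5:
  shows "\<exists>A>0. \<exists>B>0. \<forall>(D::nat) (X::point set) (k::nat) (\<delta>::real) (\<rho>::real) (L::ann).
    D \<ge> 1 \<longrightarrow> X \<subseteq> R D \<longrightarrow> finite X \<longrightarrow> X \<noteq> {} \<longrightarrow> k \<ge> 2 \<longrightarrow>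
    0 < \<delta> \<longrightarrow> \<delta> < 1 / 2 \<longrightarrow> 0 < \<rho> \<longrightarrow> \<rho> < 1 \<longrightarrow> successful_ann D \<rho> L \<longrightarrow>
    measure_pmf.expectation (kmeanspp D \<delta> L X k) (\<lambda>C. cost D X C)
      \<le> A * (ln (real k) / \<rho>\<^sup>2) * opt D k X
        + \<delta> * (B * (real k + ln (real k) / \<rho>\<^sup>2)) * opt D 1 X"
proof (rule exI[of _ 40], intro conjI exI[of _ 2] allI impI)
  fix D :: nat and X :: "point set" and k :: nat and \<delta> \<rho> :: real and L :: ann
  assume D: "D \<ge> 1" and X: "X \<subseteq> R D" "finite X" "X \<noteq> {}" and k: "k \<ge> 2"
    and \<delta>: "0 < \<delta>" "\<delta> < 1 / 2" and \<rho>: "0 < \<rho>" "\<rho> < 1" and L: "successful_ann D \<rho> L"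
  interpret ann_seeding D X \<rho> L
    by unfold_locales (use X \<rho> L in auto)
  obtain r where r: "k = Suc r" "r \<ge> 1"
    using k by (cases k) auto
  have "harm r \<le> 1 + ln (real r)"
    using r by (intro harm_le_one_plus_ln)
  also have "\<dots> \<le> 1 + ln (real k)"
    using r by simp
  finally have h: "harm r \<le> 1 + ln (real k)" .
  have "1 / 2 \<le> ln (2::real)"
    using ln2_ge_two_thirds by simp
  also have "\<dots> \<le> ln (real k)"
    using k by simp
  finally have lnk: "1 / 2 \<le> ln (real k)" .
  \<comment> \<open>From \<open>ln k \<ge> 1 / 2\<close> follows
    \<open>2 + ln k \<le> 5 * ln k\<close>; the constant 40 is 5 times 8.\<close>
  have c1: "(1 + harm r) * (8 / \<rho>\<^sup>2) \<le> 40 * (ln (real k) / \<rho>\<^sup>2)"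
  proof -
    have "(1 + harm r) * (8 / \<rho>\<^sup>2) \<le> (5 * ln (real k)) * (8 / \<rho>\<^sup>2)"
      using h lnk by (intro mult_right_mono) auto
    then show ?thesis by simp
  qed
  have c2: "\<delta> * harm r * 2 \<le> \<delta> * (2 * (real k + ln (real k) / \<rho>\<^sup>2))"
  proof -
    have "\<rho>\<^sup>2 \<le> 1" using \<rho> by (simp add: power_le_one)
    then have "ln (real k) \<le> ln (real k) / \<rho>\<^sup>2"
      using \<rho> lnk by (simp add: pos_le_divide_eq mult_left_le)
    then have "harm r \<le> real k + ln (real k) / \<rho>\<^sup>2"
      using h k by simp
    then show ?thesis using \<delta> by simp
  qed
  have "measure_pmf.expectation (kmeanspp D \<delta> L X k) (cost D X)
      \<le> (1 + harm r) * (8 / \<rho>\<^sup>2) * opt D k X + \<delta> * harm r * 2 * opt D 1 X"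
    unfolding r(1) using D \<delta> by (intro expected_cost_le_opt) auto
  also have "\<dots> \<le> 40 * (ln (real k) / \<rho>\<^sup>2) * opt D k X
      + \<delta> * (2 * (real k + ln (real k) / \<rho>\<^sup>2)) * opt D 1 X"
    using c1 c2 D k by (intro add_mono mult_right_mono opt_nonneg) auto
  finally show "measure_pmf.expectation (kmeanspp D \<delta> L X k) (\<lambda>C. cost D X C)
      \<le> 40 * (ln (real k) / \<rho>\<^sup>2) * opt D k X
        + \<delta> * (2 * (real k + ln (real k) / \<rho>\<^sup>2)) * opt D 1 X" .
qed auto

end
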